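(* For every $n\geq 2$, $\kappa^s(BH_n;K_{1,1})=2n$.
   Context: The $n$-dimensional balanced hypercube $BH_n$ is the graph with vertex set $\{0,1,2,3\}^n$, vertices written $(a_0,a_1,\dots,a_{n-1})$, in which $(a_0,\dots,a_{n-1})$ is adjacent exactly to the $2n$ vertices $((a_0\pm 1)\bmod 4,a_1,\dots,a_{n-1})$ and, for each $1\le i\le n-1$, $((a_0\pm1)\bmod 4,a_1,\dots,a_{i-1},(a_i+(-1)^{a_0})\bmod 4,a_{i+1},\dots,a_{n-1})$. For a connected graph $G$ and a set $F$ of connected subgraphs of $G$, let $V(F)$ be the union of their vertex sets; $F$ is a subgraph-cut if $G-V(F)$ is disconnected or trivial. For a connected subgraph $H$ of $G$, an $H$-substructure-cut is a subgraph-cut each of whose elements is isomorphic to a connected subgraph of $H$, and $\kappa^s(G;H)$ is the minimum cardinality of an $H$-substructure-cut. $K_{1,1}$ is the graph consisting of a single edge. *)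

theory Defs
  imports "Graph_Theory.Graph_Theory" "HOL-Library.Extended_Nat"
begin

text \<open>
  Undirected graphs are symmetric digraphs, so an undirected subgraph has to be symmetric itself:
  this is what \<open>graph K\<close> adds to \<open>subgraph K G\<close>. The library's \<open>connected\<close> includes nonemptiness.
\<close>

definition connected_subgraph :: "('a, 'b) pre_digraph \<Rightarrow> ('a, 'b) pre_digraph \<Rightarrow> bool" where
  "connected_subgraph K G \<longleftrightarrow> graph K \<and> subgraph K G \<and> connected K"

definition subgraph_cut :: "('a, 'b) pre_digraph \<Rightarrow> ('a, 'b) pre_digraph set \<Rightarrow> bool" where
  "subgraph_cut G F \<longleftrightarrow>
     (\<forall>K\<in>F. connected_subgraph K G) \<and>
     (let R = G \<restriction> (verts G - (\<Union>K\<in>F. verts K))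
      in \<not> connected R \<or> (\<exists>v. verts R = {v}))"

definition substructure_cut ::
    "('a, 'b) pre_digraph \<Rightarrow> ('c, 'd) pre_digraph \<Rightarrow> ('a, 'b) pre_digraph set \<Rightarrow> bool" where
  "substructure_cut G H F \<longleftrightarrow>
     subgraph_cut G F \<and> (\<forall>K\<in>F. \<exists>K'. connected_subgraph K' H \<and> digraph_iso K K')"

text \<open>If \<open>G\<close> is finite, every set of subgraphs of \<open>G\<close> is finite.\<close>

definition substructure_connectivity ::
    "('a, 'b) pre_digraph \<Rightarrow> ('c, 'd) pre_digraph \<Rightarrow> enat" (\<open>\<kappa>\<^sup>s\<close>) where
  "\<kappa>\<^sup>s G H = Inf {enat (card F) | F. finite F \<and> substructure_cut G H F}"

definition BH_verts :: "nat \<Rightarrow> int list set" where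
  "BH_verts n = {a. length a = n \<and> set a \<subseteq> {0, 1, 2, 3}}"

definition BH_nbrs :: "nat \<Rightarrow> int list \<Rightarrow> int list set" where
  "BH_nbrs n a =
     {a[0 := (a ! 0 + s) mod 4] | s. s \<in> {1, -1}} \<union>
     {a[0 := (a ! 0 + s) mod 4, i := (a ! i + (-1) ^ nat (a ! 0)) mod 4] | s i.
        s \<in> {1, -1} \<and> 1 \<le> i \<and> i \<le> n - 1}"

text \<open>The balanced hypercube; meaningful for dimension at least 1.\<close>

definition BH :: "nat \<Rightarrow> int list pair_pre_digraph" where
  "BH n = \<lparr> pverts = BH_verts n, parcs = {(a, b). a \<in> BH_verts n \<and> b \<in> BH_nbrs n a} \<rparr>"

end

theory Submission
  imports Defs
begin

text \<open>
  The neighbours of a vertex are \<open>2n\<close> single vertices whose removal isolates it, so \<open>2n\<close> is an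
  upper bound. For the lower bound, remove at most \<open>2n - 1\<close> cliques and induct on \<open>n\<close>, splitting
  \<open>BH\<^sub>n\<close> into four copies of \<open>BH\<^sub>n\<^sub>-\<^sub>1\<close> arranged in a cycle by one coordinate \<open>c\<close>. Even vertices of
  copy \<open>c\<close> are joined to odd vertices of copy \<open>c + 1\<close>. Vertices \<open>a\<close>, \<open>a + 2\<close> in the coordinate 0 have
  the same neighbours, and two distinct cliques are needed to remove both.

  If every copy meets at most \<open>2n - 3\<close> of the cliques, each copy stays connected by induction, and
  counting shows that an edge survives between any two consecutive copies. Otherwise all cliques but
  at most one meet a single copy \<open>c\<close>. Then at most one clique comes near the opposite copy \<open>c + 2\<close>, so
  this copy stays connected and every surviving vertex of the copies \<open>c \<plusminus> 1\<close> reaches it. Finally every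
  surviving vertex of copy \<open>c\<close> reaches another copy in at most two steps: blocking all of the \<open>n\<close>
  ways out (one direct, \<open>n - 1\<close> through a neighbour in the copy) takes two cliques for each.
\<close>

section \<open>Adjacency on lists\<close>

text \<open>
  Vertices of \<open>BH\<^sub>n\<close> are lists \<open>a # x\<close>. The first entry of a neighbour \<open>b # y\<close> is any entry of the
  other parity, and \<open>y\<close> arises from \<open>x\<close> by adding \<open>sg a\<close> to at most one entry.
\<close>

definition sg :: "int \<Rightarrow> int" where
  "sg a = (if even a then 1 else -1)"

fun step :: "int \<Rightarrow> int list \<Rightarrow> int list \<Rightarrow> bool" where
  "step s [] [] = True"
| "step s (c # x) (d # y) = (c = d \<and> step s x y \<or> d = (c + s) mod 4 \<and> x = y)"
| "step s _ _ = False"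

fun adj :: "int list \<Rightarrow> int list \<Rightarrow> bool" where
  "adj (a # x) (b # y) = (even a \<noteq> even b \<and> step (sg a) x y)"
| "adj _ _ = False"

lemma sg_cases: "sg a = 1 \<or> sg a = -1"
  by (simp add: sg_def)

lemma sg_opposite: "even a \<noteq> even b \<Longrightarrow> sg b = - sg a"
  by (auto simp: sg_def)

lemma BH_verts_Nil [simp]: "[] \<in> BH_verts n \<longleftrightarrow> n = 0"
  by (auto simp: BH_verts_def)

lemma BH_verts_0 [simp]: "x \<in> BH_verts 0 \<longleftrightarrow> x = []"
  by (auto simp: BH_verts_def)

lemma BH_verts_Cons [simp]:
  "a # x \<in> BH_verts (Suc n) \<longleftrightarrow> a \<in> {0, 1, 2, 3} \<and> x \<in> BH_verts n"
  by (auto simp: BH_verts_def)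

lemma BH_verts_SucE:
  assumes "u \<in> BH_verts (Suc n)"
  obtains a x where "u = a # x" "a \<in> {0, 1, 2, 3}" "x \<in> BH_verts n"
  using assms by (cases u) (auto simp: BH_verts_def)

lemma mod4_in: "(c :: int) mod 4 \<in> {0, 1, 2, 3}"
  by (simp; presburger)

lemma finite_BH_verts: "finite (BH_verts n)"
  using finite_lists_length_eq[of "{0, 1, 2, 3 :: int}" n] by (simp add: BH_verts_def conj_commute)

lemma card_BH_verts: "card (BH_verts n) = 4 ^ n"
  using card_lists_length_eq[of "{0, 1, 2, 3 :: int}" n]
  by (simp add: BH_verts_def conj_commute numeral_eq_Suc)

lemma step_refl: "step s x x"
  by (induction x) auto

lemma step_closed: "step s x y \<Longrightarrow> x \<in> BH_verts n \<Longrightarrow> y \<in> BH_verts n"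
proof (induction s x y arbitrary: n rule: step.induct)
  case (2 s c x d y)
  then obtain m where "n = Suc m" by (cases n) auto
  with 2 show ?case using mod4_in[of "c + s"] by auto
qed auto

lemma mod4_shift:
  fixes c d s :: int
  assumes "c \<in> {0, 1, 2, 3}" "d \<in> {0, 1, 2, 3}" "s = 1 \<or> s = -1"
  shows "d = (c + s) mod 4 \<longleftrightarrow> c = (d - s) mod 4"
  using assms by (elim insertE emptyE disjE) simp_all

lemma mod4_shift_neq:
  fixes c s :: int
  assumes "s = 1 \<or> s = -1"
  shows "c \<noteq> (c + s) mod 4"
  using assms by (elim disjE; simp; presburger)

lemma step_sym:
  "s = 1 \<or> s = -1 \<Longrightarrow> step s x y \<Longrightarrow> x \<in> BH_verts n \<Longrightarrow> y \<in> BH_verts n \<Longrightarrow> step (- s) y x"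
proof (induction s x y arbitrary: n rule: step.induct)
  case (2 s c x d y)
  then obtain m where "n = Suc m" by (cases n) auto
  then have "c \<in> {0,1,2,3}" "d \<in> {0,1,2,3}" "x \<in> BH_verts m" "y \<in> BH_verts m"
    using 2 by auto
  then show ?case using 2 mod4_shift[of c d s] by auto
qed auto

text \<open>The ends of an edge have first entries of opposite parity, hence opposite signs, so a
  shift by \<open>sg a\<close> is undone by a shift by \<open>sg b\<close>.\<close>

lemma adj_sym:
  assumes "adj u v" "u \<in> BH_verts n" "v \<in> BH_verts n"
  shows "adj v u"
proof -
  obtain a x b y where "u = a # x" "v = b # y" "even a \<noteq> even b" "step (sg a) x y"
    using assms(1) by (cases "(u, v)" rule: adj.cases) auto
  moreover obtain m where "n = Suc m" using assms calculation by (cases n) auto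
  ultimately show ?thesis
    using assms step_sym[of "sg a" x y m] sg_cases[of a] sg_opposite[of a b] by auto
qed

lemma step_set_Cons:
  "{y. step s (c # x) y} = insert ((c + s) mod 4 # x) ((#) c ` {y. step s x y})"
proof (rule set_eqI)
  fix y
  show "y \<in> {y. step s (c # x) y} \<longleftrightarrow> y \<in> insert ((c + s) mod 4 # x) ((#) c ` {y. step s x y})"
    by (cases y) auto
qed

text \<open>One result leaves \<open>x\<close> unchanged, and each entry contributes one more by
  being shifted; they are distinct since \<open>(c + s) mod 4\<close> is never
  \<open>c\<close>.\<close>

lemma card_step:
  assumes "s = 1 \<or> s = -1"
  shows "finite {y. step s x y} \<and> card {y. step s x y} = Suc (length x)"
proof (induction x)
  case Nil
  have "{y. step s [] y} = {[]}"
  proof (rule set_eqI)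
    fix y show "y \<in> {y. step s [] y} \<longleftrightarrow> y \<in> {[]}" by (cases y) auto
  qed
  then show ?case by simp
next
  case (Cons c x)
  have "(c + s) mod 4 # x \<notin> (#) c ` {y. step s x y}"
    using mod4_shift_neq[OF assms, of c] by auto
  with Cons show ?case
    by (simp add: step_set_Cons card_image)
qed

section \<open>Cliques, surviving vertices and twins\<close>

text \<open>The removed subgraphs enter the induction only through their vertex sets, and this
  property of them passes to their slices in the copies.\<close>

definition clique :: "int list set \<Rightarrow> bool" where
  "clique f \<longleftrightarrow> (\<forall>u\<in>f. \<forall>v\<in>f. u \<noteq> v \<longrightarrow> adj u v)"

definition live :: "nat \<Rightarrow> int list set set \<Rightarrow> int list set" where
  "live n F = BH_verts n - \<Union>F"

definition link :: "nat \<Rightarrow> int list set set \<Rightarrow> (int list \<times> int list) set" where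
  "link n F = {(u, v). u \<in> live n F \<and> v \<in> live n F \<and> adj u v}"

text \<open>Lists with a common tail whose first entries lie in one class are twins: they have the
  same neighbours.\<close>

definition parity_class :: "bool \<Rightarrow> int set" where
  "parity_class p = (if p then {0, 2} else {1, 3})"

lemma even_parity_class: "b \<in> parity_class p \<Longrightarrow> even b = p"
  by (auto simp: parity_class_def split: if_splits)

lemma parity_class_verts: "b \<in> parity_class p \<Longrightarrow> b \<in> {0, 1, 2, 3}"
  by (auto simp: parity_class_def split: if_splits)

lemma sym_link: "sym (link n F)"
  by (auto simp: sym_def link_def live_def dest: adj_sym)

lemma link_rtrancl_sym: "(u, v) \<in> (link n F)\<^sup>* \<Longrightarrow> (v, u) \<in> (link n F)\<^sup>*"
  using sym_rtrancl[OF sym_link] by (auto dest: symD)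

lemma cliqueD: "clique f \<Longrightarrow> u \<in> f \<Longrightarrow> v \<in> f \<Longrightarrow> u \<noteq> v \<Longrightarrow> adj u v"
  by (simp add: clique_def)

text \<open>Edges join first entries of opposite parity, so a clique has at most one vertex of each
  parity.\<close>

lemma clique_same_parity:
  assumes "clique f" "a # x \<in> f" "b # y \<in> f" "even a = even b"
  shows "a = b \<and> x = y"
proof (rule ccontr)
  assume "\<not> ?thesis"
  then have "adj (a # x) (b # y)" using assms(1-3) by (intro cliqueD) auto
  then show False using assms(4) by simp
qed

text \<open>Twins are not adjacent, so different cliques contain them. \<open>Q\<close> describes
  the cliques that an application wants to count.\<close>

lemma two_cliques_cover_class:
  assumes "finite F" "\<And>f. f \<in> F \<Longrightarrow> clique f"
    and "\<And>b. b \<in> parity_class p \<Longrightarrow> b # x \<in> \<Union>F"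
    and "\<And>b f. b \<in> parity_class p \<Longrightarrow> f \<in> F \<Longrightarrow> b # x \<in> f \<Longrightarrow> Q f"
  shows "2 \<le> card {f \<in> F. Q f}"
proof -
  obtain b c where bc: "b \<in> parity_class p" "c \<in> parity_class p" "b \<noteq> c"
    using that[of 0 2] that[of 1 3] by (cases p) (auto simp: parity_class_def)
  then obtain f g where fg: "f \<in> F" "b # x \<in> f" "g \<in> F" "c # x \<in> g"
    using assms(3) by (meson UnionE)
  have "f \<noteq> g"
    using clique_same_parity[of f b x c x] fg bc assms(2) even_parity_class by metis
  then have "card {f, g} = 2" by simp
  moreover have "{f, g} \<subseteq> {f \<in> F. Q f}" using fg bc assms(4) by auto
  ultimately show ?thesis using assms(1) card_mono[of "{f \<in> F. Q f}" "{f, g}"] by simp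
qed

lemma live_in_class:
  assumes "finite F" "\<And>f. f \<in> F \<Longrightarrow> clique f" "card {f \<in> F. Q f} \<le> 1"
    and "\<And>b f. b \<in> parity_class p \<Longrightarrow> f \<in> F \<Longrightarrow> b # x \<in> f \<Longrightarrow> Q f"
    and "x \<in> BH_verts n"
  obtains b where "b \<in> parity_class p" "b # x \<in> live (Suc n) F"
proof -
  have "\<exists>b\<in>parity_class p. b # x \<notin> \<Union>F"
  proof (rule ccontr)
    assume "\<not> ?thesis"
    then have "2 \<le> card {f \<in> F. Q f}"
      using assms by (intro two_cliques_cover_class) auto
    then show False using assms(3) by simp
  qed
  then show ?thesis using that assms(5) parity_class_verts by (fastforce simp: live_def)
qed

section \<open>Counting the cliques that block the ways out of a copy\<close>

text \<open>Read \<open>Q i f\<close> as: \<open>f\<close> is charged to \<open>i\<close>. Every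
  \<open>i\<close> receives at least two cliques, and no clique is charged to two indices.\<close>

lemma double_count:
  assumes "finite F" "finite I"
    and "\<And>i. i \<in> I \<Longrightarrow> 2 \<le> card {f \<in> F. Q i f}"
    and "\<And>i j f. i \<in> I \<Longrightarrow> j \<in> I \<Longrightarrow> f \<in> F \<Longrightarrow> Q i f \<Longrightarrow> Q j f \<Longrightarrow> i = j"
  shows "2 * card I \<le> card F"
proof -
  have "2 * card I = (\<Sum>i\<in>I. 2)" by simp
  also have "\<dots> \<le> (\<Sum>i\<in>I. card {f \<in> F. Q i f})"
    using assms(3) by (rule sum_mono)
  also have "\<dots> = card (\<Union>i\<in>I. {f \<in> F. Q i f})"
    using assms by (intro card_UN_disjoint[symmetric]) auto
  also have "\<dots> \<le> card F"
    using assms(1) by (intro card_mono) auto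
  finally show ?thesis .
qed

text \<open>If only copy \<open>c\<close> were reachable, each of the \<open>k + 2\<close> tails
  \<open>y\<close> of neighbours would be blocked by two cliques, and no clique blocks two tails.
  That takes \<open>2 * k + 4\<close> cliques, one more than allowed.\<close>

lemma escape:
  assumes fin: "finite F" and cl: "\<And>f. f \<in> F \<Longrightarrow> clique f" and cd: "card F \<le> 2 * k + 3"
    and v: "a # c # x \<in> live (Suc (Suc k)) F"
  shows "\<exists>b d y. d \<noteq> c \<and> b # d # y \<in> live (Suc (Suc k)) F \<and>
           (a # c # x, b # d # y) \<in> (link (Suc (Suc k)) F)\<^sup>*"
proof (rule ccontr)
  assume "\<not> ?thesis"
  then have no: "d = c" if "b # d # y \<in> live (Suc (Suc k)) F"
      "(a # c # x, b # d # y) \<in> (link (Suc (Suc k)) F)\<^sup>*" for b d y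
    using that by blast
  define s where "s = sg a"
  have s: "s = 1 \<or> s = -1" using sg_cases s_def by auto
  define I where "I = {y. step s (c # x) y}"
  have ax: "a \<in> {0,1,2,3}" "c \<in> {0,1,2,3}" "x \<in> BH_verts k"
    using v by (auto simp: live_def)
  have I: "finite I" "card I = k + 2"
    using card_step[OF s, of "c # x"] ax by (auto simp: I_def BH_verts_def)
  have Iv: "y \<in> BH_verts (Suc k)" if "y \<in> I" for y
    using that step_closed[of s "c # x" y "Suc k"] ax by (auto simp: I_def)
  \<comment> \<open>The clique \<open>f\<close> meets the way out of the copy that starts towards \<open>y\<close>.\<close>
  define Q where "Q y f \<longleftrightarrow> (\<exists>b\<in>parity_class (odd a). b # y \<in> f) \<or>
      hd y = c \<and> (\<exists>b\<in>parity_class (even a). b # (c - s) mod 4 # tl y \<in> f)" for y f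
  have hdI: "\<exists>e z. y = e # z \<and> e \<in> {c, (c + s) mod 4}" if "y \<in> I" for y
    using that by (cases y) (auto simp: I_def)
  have ne: "(c - s) mod 4 \<noteq> c" "(c - s) mod 4 \<noteq> (c + s) mod 4" 
    using s ax(2) by auto
  have "2 * card I \<le> card F"
  proof (rule double_count[OF fin I(1), of Q])
    fix y assume y: "y \<in> I"
    then obtain e z where ez: "y = e # z" "e \<in> {c, (c + s) mod 4}" using hdI by blast
    show "2 \<le> card {f \<in> F. Q y f}"
    proof (cases "\<forall>b\<in>parity_class (odd a). b # y \<in> \<Union>F")
      case True
      then show ?thesis
        by (intro two_cliques_cover_class[of F "odd a" y] fin cl) (auto simp: Q_def)
    next
      case False
      then obtain b where b: "b \<in> parity_class (odd a)" "b # y \<notin> \<Union>F" by auto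
      then have lb: "b # y \<in> live (Suc (Suc k)) F"
        using Iv[OF y] parity_class_verts[OF b(1)] by (simp add: live_def)
      have "adj (a # c # x) (b # y)"
        using y even_parity_class[OF b(1)] by (simp add: I_def s_def)
      then have ab: "(a # c # x, b # y) \<in> link (Suc (Suc k)) F"
        using v lb by (simp add: link_def)
      then have ec: "e = c" using no[of b e z] lb by (simp add: ez r_into_rtrancl)
      \<comment> \<open>The surviving vertex \<open>b # c # z\<close> has the sign
        \<open>- s\<close>, so its cross edges lead to both twins in copy \<open>c - s\<close>.
        Neither may survive, since both would be reachable.\<close>
      have "w # (c - s) mod 4 # z \<in> \<Union>F" if w: "w \<in> parity_class (even a)" for w
      proof (rule ccontr)
        assume "\<not> ?thesis"
        then have lw: "w # (c - s) mod 4 # z \<in> live (Suc (Suc k)) F"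
          using Iv[OF y] parity_class_verts[OF w] mod4_in[of "c - s"] by (simp add: live_def ez)
        have "sg b = - s"
          using even_parity_class[OF b(1)] sg_opposite[of a b] by (simp add: s_def)
        then have "adj (b # y) (w # (c - s) mod 4 # z)"
          using even_parity_class[OF b(1)] even_parity_class[OF w] by (simp add: ez ec)
        then have "(b # y, w # (c - s) mod 4 # z) \<in> link (Suc (Suc k)) F"
          using lb lw by (simp add: link_def)
        then show False using no[OF lw] ab ne(1) by (meson converse_rtrancl_into_rtrancl r_into_rtrancl)
      qed
      then show ?thesis
        by (intro two_cliques_cover_class[of F "even a" "(c - s) mod 4 # z"] fin cl)
          (auto simp: Q_def ez ec)
    qed
  next
    fix y y' f
    assume *: "y \<in> I" "y' \<in> I" "f \<in> F" "Q y f" "Q y' f"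
    obtain e z where ez: "y = e # z" "e \<in> {c, (c + s) mod 4}" using hdI * by blast
    obtain e' z' where ez': "y' = e' # z'" "e' \<in> {c, (c + s) mod 4}" using hdI * by blast
    note f = cl[OF \<open>f \<in> F\<close>]
    \<comment> \<open>An edge from \<open>b # u\<close> into copy \<open>c - s\<close> shifts the
      second entry by \<open>- s\<close>. Hence \<open>u\<close> begins with \<open>c\<close>, and
      the remaining entries agree.\<close>
    have cross: "u = c # w"
      if "b \<in> parity_class (odd a)" "b # u \<in> f" "u \<in> I"
        "b' \<in> parity_class (even a)" "b' # (c - s) mod 4 # w \<in> f" for b u b' w
    proof -
      obtain g h where gh: "u = g # h" "g \<in> {c, (c + s) mod 4}" using hdI \<open>u \<in> I\<close> by blast
      have p: "even b = odd a" "even b' = even a"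
        using that even_parity_class by auto
      then have "b # u \<noteq> b' # (c - s) mod 4 # w" by auto
      then have "adj (b # u) (b' # (c - s) mod 4 # w)" using that f by (intro cliqueD)
      moreover have "sg b = - s" using p sg_opposite[of a b] by (simp add: s_def)
      moreover have "(c - s) mod 4 \<noteq> g" using gh(2) ne by auto
      ultimately have "(c - s) mod 4 = (g - s) mod 4 \<and> h = w" by (auto simp: gh)
      moreover have "(c - s) mod 4 \<noteq> ((c + s) mod 4 - s) mod 4" 
        using ax(2) s by auto
      ultimately show ?thesis using gh by auto
    qed
    consider (1) b b' where "b \<in> parity_class (odd a)" "b # y \<in> f" "b' \<in> parity_class (odd a)" "b' # y' \<in> f"
      | (2) b b' where "b \<in> parity_class (odd a)" "b # y \<in> f" "b' \<in> parity_class (even a)"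
          "e' = c" "b' # (c - s) mod 4 # z' \<in> f"
      | (3) b b' where "b \<in> parity_class (odd a)" "b # y' \<in> f" "b' \<in> parity_class (even a)"
          "e = c" "b' # (c - s) mod 4 # z \<in> f"
      | (4) b b' where "b \<in> parity_class (even a)" "e = c" "b # (c - s) mod 4 # z \<in> f"
          "b' \<in> parity_class (even a)" "e' = c" "b' # (c - s) mod 4 # z' \<in> f"
      using *(4,5) by (auto simp: Q_def ez ez')
    then show "y = y'"
    proof cases
      case 1 then show ?thesis using clique_same_parity[OF f] even_parity_class by metis
    next
      case 2 then show ?thesis using cross[of b y b' z'] *(1) ez' by auto
    next
      case 3 then show ?thesis using cross[of b y' b' z] *(2) ez by auto
    next
      case 4
      then have "(c - s) mod 4 # z = (c - s) mod 4 # z'"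
        using clique_same_parity[OF f] even_parity_class by metis
      then show ?thesis using 4 ez ez' by simp
    qed
  qed
  then show False using I cd by simp
qed


section \<open>Restriction to one copy\<close>

text \<open>The copies of \<open>BH\<^sub>n\<^sub>-\<^sub>1\<close> are indexed by the second list entry.\<close>

definition slice :: "int \<Rightarrow> int list set \<Rightarrow> int list set" where
  "slice c f = {a # x | a x. a # c # x \<in> f}"

text \<open>An edge within one copy does not shift the second entry, so deleting that entry
  preserves adjacency.\<close>

lemma clique_slice:
  assumes "clique f"
  shows "clique (slice c f)"
  unfolding clique_def
proof (intro ballI impI)
  fix u v assume "u \<in> slice c f" "v \<in> slice c f" "u \<noteq> v"
  then obtain a x b y where *: "u = a # x" "v = b # y" "a # c # x \<in> f" "b # c # y \<in> f"
    by (auto simp: slice_def)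
  then have "adj (a # c # x) (b # c # y)"
    using assms \<open>u \<noteq> v\<close> by (intro cliqueD) auto
  then show "adj u v"
    using * mod4_shift_neq[OF sg_cases, of c a] by auto
qed

text \<open>Only reachability is demanded, so the property is vacuous if nothing survives;
  \<open>live_two\<close> supplies the survivors.\<close>

definition cliques_removable :: "nat \<Rightarrow> nat \<Rightarrow> bool" where
  "cliques_removable n m \<longleftrightarrow>
     (\<forall>F u v. finite F \<longrightarrow> card F \<le> m \<longrightarrow> (\<forall>f\<in>F. clique f) \<longrightarrow>
        u \<in> live n F \<longrightarrow> v \<in> live n F \<longrightarrow> (u, v) \<in> (link n F)\<^sup>*)"

text \<open>Deleting the entry \<open>c\<close> identifies the copy with the hypercube of one
  dimension less. Cliques with empty slice are dropped, so only those that meet the copy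
  count.\<close>

lemma copy_connected:
  assumes IH: "cliques_removable (Suc k) m"
    and fin: "finite F" and cl: "\<And>f. f \<in> F \<Longrightarrow> clique f"
    and cd: "card {f \<in> F. slice c f \<noteq> {}} \<le> m"
    and uv: "a # c # x \<in> live (Suc (Suc k)) F" "b # c # y \<in> live (Suc (Suc k)) F"
  shows "(a # c # x, b # c # y) \<in> (link (Suc (Suc k)) F)\<^sup>*"
proof -
  define F' where "F' = slice c ` {f \<in> F. slice c f \<noteq> {}}"
  have live_iff: "a # x \<in> live (Suc k) F' \<longleftrightarrow> a # c # x \<in> live (Suc (Suc k)) F"
    if "c \<in> {0, 1, 2, 3}" for a x
    using that by (auto simp: live_def F'_def slice_def)
  have c: "c \<in> {0, 1, 2, 3}" using uv by (simp add: live_def)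
  have "finite F'" using fin by (simp add: F'_def)
  moreover have "card F' \<le> m"
    using cd card_image_le[of "{f \<in> F. slice c f \<noteq> {}}" "slice c"] fin by (simp add: F'_def)
  moreover have "clique f" if "f \<in> F'" for f
    using that cl clique_slice by (auto simp: F'_def)
  ultimately have "(a # x, b # y) \<in> (link (Suc k) F')\<^sup>*"
    using IH uv live_iff[OF c] unfolding cliques_removable_def by blast
  \<comment> \<open>Written with \<open>hd\<close> and \<open>tl\<close>, the claim reinserts
    \<open>c\<close> into arbitrary vertices and so can be carried along the path.\<close>
  then have "(hd (a # x) # c # tl (a # x), hd (b # y) # c # tl (b # y)) \<in> (link (Suc (Suc k)) F)\<^sup>*"
  proof (induction rule: rtrancl_induct)
    case base show ?case by simp
  next
    case (step v w)
    then obtain a' x' b' y' where "v = a' # x'" "w = b' # y'"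
      by (cases "(v, w)" rule: adj.cases) (auto simp: link_def)
    with step(2) have "(hd v # c # tl v, hd w # c # tl w) \<in> link (Suc (Suc k)) F"
      using live_iff[OF c] by (auto simp: link_def)
    with step(3) show ?case by (rule rtrancl_into_rtrancl)
  qed
  then show ?thesis by simp
qed

section \<open>Dimension one\<close>

text \<open>The graph is a 4-cycle. One clique cannot remove both twins, so two survivors of equal
  parity keep a common neighbour \<open>[w]\<close>.\<close>

lemma connected_base:
  assumes fin: "finite F" and cl: "\<And>f. f \<in> F \<Longrightarrow> clique f" and cd: "card F \<le> 1"
    and uv: "u \<in> live (Suc 0) F" "v \<in> live (Suc 0) F"
  shows "(u, v) \<in> (link (Suc 0) F)\<^sup>*"
proof -
  obtain a b where ab: "u = [a]" "v = [b]" "a \<in> {0,1,2,3}" "b \<in> {0,1,2,3}"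
    using uv by (auto simp: live_def elim!: BH_verts_SucE)
  obtain w where w: "w \<in> parity_class (odd a)" "[w] \<in> live (Suc 0) F"
    using live_in_class[of F "\<lambda>_. True" "odd a" "[]" 0] fin cl cd by auto
  have pw: "even w = odd a" using even_parity_class[OF w(1)] .
  have lk: "([p], [q]) \<in> link (Suc 0) F"
    if "[p] \<in> live (Suc 0) F" "[q] \<in> live (Suc 0) F" "even p \<noteq> even q" for p q
    using that by (auto simp: link_def)
  show ?thesis
  proof (cases "even a = even b")
    case True
    then have "(u, [w]) \<in> link (Suc 0) F" "([w], v) \<in> link (Suc 0) F"
      using lk uv w pw by (auto simp: ab)
    then show ?thesis by (meson converse_rtrancl_into_rtrancl r_into_rtrancl)
  next
    case False
    then show ?thesis using lk uv by (auto simp: ab)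
  qed
qed

section \<open>One copy meets almost all cliques\<close>

text \<open>Both twins with tail \<open>y\<close> are neighbours of \<open>a # x\<close>, and a
  single clique near them leaves one alive.\<close>

lemma partner_in_class:
  assumes fin: "finite F" and cl: "\<And>f. f \<in> F \<Longrightarrow> clique f" and "card {f \<in> F. Q f} \<le> 1"
    and v: "a # x \<in> live (Suc n) F" and y: "step (sg a) x y"
    and Q: "\<And>b f. even b = odd a \<Longrightarrow> f \<in> F \<Longrightarrow> b # y \<in> f \<Longrightarrow> Q f"
  obtains b where "even b = odd a" "b # y \<in> live (Suc n) F" "(a # x, b # y) \<in> link (Suc n) F"
proof -
  have "y \<in> BH_verts n" using v y step_closed by (auto simp: live_def)
  then obtain b where b: "b \<in> parity_class (odd a)" "b # y \<in> live (Suc n) F"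
    using live_in_class[of F Q "odd a" y n] fin cl assms(3) Q even_parity_class by metis
  show ?thesis
    using that[of b] b v y even_parity_class[OF b(1)] by (auto simp: link_def)
qed

text \<open>A copy other than \<open>c\<close> and \<open>c + 2\<close> is next to
  \<open>c + 2\<close>, so one of the two signs leads there.\<close>

lemma mod4_opposite:
  fixes c e s :: int
  assumes "c \<in> {0, 1, 2, 3}" "e \<in> {0, 1, 2, 3}" "s = 1 \<or> s = -1"
    and "e \<noteq> c" "e \<noteq> (c + 2) mod 4" "(e + s) mod 4 \<noteq> (c + 2) mod 4"
  shows "(e - s) mod 4 = (c + 2) mod 4"
  using assms by (elim insertE emptyE disjE) simp_all

lemma mod4_far:
  fixes c e s :: int
  assumes "c \<in> {0, 1, 2, 3}" "s = 1 \<or> s = -1"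
    and "e = (c + 2) mod 4 \<or> (e + s) mod 4 = (c + 2) mod 4"
  shows "e \<noteq> c" "c \<noteq> (e + s) mod 4"
  using assms by (elim insertE emptyE disjE; force)+

text \<open>At most \<open>(2 * k + 3) - (2 * k + 2) = 1\<close> clique avoids copy
  \<open>c\<close>. Near the opposite copy \<open>d\<close> every pair of twins therefore keeps a
  survivor, and all survivors are led to \<open>d\<close>.\<close>

lemma connected_crowded:
  assumes IH: "cliques_removable (Suc k) (2 * k + 1)"
    and fin: "finite F" and cl: "\<And>f. f \<in> F \<Longrightarrow> clique f" and cd: "card F \<le> 2 * k + 3"
    and c: "c \<in> {0, 1, 2, 3}" and crowd: "2 * k + 2 \<le> card {f \<in> F. slice c f \<noteq> {}}"
    and uv: "u \<in> live (Suc (Suc k)) F" "v \<in> live (Suc (Suc k)) F"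
  shows "(u, v) \<in> (link (Suc (Suc k)) F)\<^sup>*"
proof -
  define d where "d = (c + 2) mod 4"
  \<comment> \<open>The clique \<open>f\<close> meets copy \<open>d\<close> or a vertex whose cross edges lead to copy \<open>d\<close>; such a clique
    cannot meet copy \<open>c\<close>.\<close>
  define Q where "Q f \<longleftrightarrow> (\<exists>b e y. b # e # y \<in> f \<and> (e = d \<or> (e + sg b) mod 4 = d))" for f
  have "{f \<in> F. Q f} \<subseteq> F - {f \<in> F. slice c f \<noteq> {}}"
  proof
    fix f assume f: "f \<in> {f \<in> F. Q f}"
    then obtain b e y where bey: "b # e # y \<in> f" "e = d \<or> (e + sg b) mod 4 = d"
      by (auto simp: Q_def)
    note far = mod4_far[OF c sg_cases bey(2)[unfolded d_def]]
    have "slice c f = {}"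
    proof (rule ccontr)
      assume "\<not> ?thesis"
      then obtain a x where ax: "a # c # x \<in> f" by (auto simp: slice_def)
      then have "adj (b # e # y) (a # c # x)"
        using cl f bey far(1) by (intro cliqueD[of f]) auto
      then show False using far by simp
    qed
    then show "f \<in> F - {f \<in> F. slice c f \<noteq> {}}" using f by simp
  qed
  then have "card {f \<in> F. Q f} \<le> card (F - {f \<in> F. slice c f \<noteq> {}})"
    using fin by (intro card_mono) auto
  also have "\<dots> = card F - card {f \<in> F. slice c f \<noteq> {}}"
    using fin by (intro card_Diff_subset) auto
  also have "\<dots> \<le> 1" using cd crowd by simp
  finally have Q1: "card {f \<in> F. Q f} \<le> 1" .
  have facing: "\<exists>b y. b # d # y \<in> live (Suc (Suc k)) F \<and>
        (a # e # x, b # d # y) \<in> (link (Suc (Suc k)) F)\<^sup>*"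
    if l: "a # e # x \<in> live (Suc (Suc k)) F" and "(e + sg a) mod 4 = d" for a e x
  proof (rule partner_in_class[OF fin cl Q1 l, of "d # x"])
    show "step (sg a) (e # x) (d # x)" using that by simp
    show "Q f" if "f \<in> F" "b # d # x \<in> f" for b f using that by (auto simp: Q_def)
  qed auto
  have to_d: "\<exists>b y. b # d # y \<in> live (Suc (Suc k)) F \<and>
        (a # e # x, b # d # y) \<in> (link (Suc (Suc k)) F)\<^sup>*"
    if l: "a # e # x \<in> live (Suc (Suc k)) F" and "e \<noteq> c" for a e x
  proof -
    have e: "e \<in> {0, 1, 2, 3}" using l by (simp add: live_def)
    consider "e = d" | "(e + sg a) mod 4 = d" | "(e - sg a) mod 4 = d"
      using mod4_opposite[OF c e sg_cases[of a] \<open>e \<noteq> c\<close>] d_def by blast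
    then show ?thesis
    proof cases
      case 1 then show ?thesis using l by auto
    next
      case 2 then show ?thesis using facing l by blast
    next
      case 3
      \<comment> \<open>The cross edges of this vertex lead away from \<open>d\<close>. A neighbour
        with the same tail has the opposite sign, and its cross edges lead to
        \<open>d\<close>.\<close>
      have op: "sg b = - sg a" if "even b = odd a" for b using sg_opposite[of a b] that by auto
      have "Q f" if "even b = odd a" "f \<in> F" "b # e # x \<in> f" for b f
      proof -
        have "(e + sg b) mod 4 = d" using op[OF that(1)] 3 by simp
        then show ?thesis using that(3) unfolding Q_def by blast
      qed
      then obtain b where b: "even b = odd a" "b # e # x \<in> live (Suc (Suc k)) F"
          "(a # e # x, b # e # x) \<in> link (Suc (Suc k)) F"
        using partner_in_class[OF fin cl Q1 l step_refl] by metis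
      then show ?thesis
        using facing[OF b(2)] op[OF b(1)] 3 by (auto intro: converse_rtrancl_into_rtrancl)
    qed
  qed
  have all_to_d: "\<exists>b y. b # d # y \<in> live (Suc (Suc k)) F \<and>
        (w, b # d # y) \<in> (link (Suc (Suc k)) F)\<^sup>*"
    if w: "w \<in> live (Suc (Suc k)) F" for w
  proof -
    obtain a e x where w_eq: "w = a # e # x"
      using w by (auto simp: live_def elim!: BH_verts_SucE)
    show ?thesis
    proof (cases "e = c")
      case True
      with w w_eq obtain b e' y where "e' \<noteq> c" "b # e' # y \<in> live (Suc (Suc k)) F"
          "(w, b # e' # y) \<in> (link (Suc (Suc k)) F)\<^sup>*"
        using escape[OF fin cl cd, of a c x] by blast
      then show ?thesis using to_d[of b e' y] by (meson rtrancl_trans)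
    next
      case False
      then show ?thesis using to_d w w_eq by blast
    qed
  qed
  obtain b y b' y' where l: "b # d # y \<in> live (Suc (Suc k)) F" "b' # d # y' \<in> live (Suc (Suc k)) F"
    and r: "(u, b # d # y) \<in> (link (Suc (Suc k)) F)\<^sup>*" "(v, b' # d # y') \<in> (link (Suc (Suc k)) F)\<^sup>*"
    using all_to_d uv by meson
  have "card {f \<in> F. slice d f \<noteq> {}} \<le> card {f \<in> F. Q f}"
    using fin by (intro card_mono) (auto simp: Q_def slice_def)
  then have "card {f \<in> F. slice d f \<noteq> {}} \<le> 2 * k + 1" using Q1 by simp
  then have "(b # d # y, b' # d # y') \<in> (link (Suc (Suc k)) F)\<^sup>*"
    using copy_connected[OF IH fin cl _ l] by blast
  then show ?thesis using r link_rtrancl_sym by (meson rtrancl_trans)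
qed

section \<open>The cliques are spread over the copies\<close>

lemma four_power_gt: "k \<ge> 1 \<Longrightarrow> 2 * k + 3 < 2 * (4 :: nat) ^ k"
  by (induction k rule: nat_induct_at_least) auto

text \<open>For each tail \<open>x\<close>, all edges from even \<open>a # c # x\<close> to odd
  \<open>b # d # x\<close> vanish only if one of the two pairs of twins is removed. This takes two
  cliques, different ones for different \<open>x\<close>, hence \<open>2 * 4 ^ k\<close> in all, too
  many if \<open>k\<close> is positive.\<close>

lemma joint:
  assumes fin: "finite F" and cl: "\<And>f. f \<in> F \<Longrightarrow> clique f" and cd: "card F \<le> 2 * k + 3"
    and sp: "\<And>c. c \<in> {0, 1, 2, 3} \<Longrightarrow> card {f \<in> F. slice c f \<noteq> {}} \<le> 2 * k + 1"
    and c: "c \<in> {0, 1, 2, 3}" and d: "d = (c + 1) mod 4"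
  obtains a b x where "a # c # x \<in> live (Suc (Suc k)) F" "b # d # x \<in> live (Suc (Suc k)) F"
    "(a # c # x, b # d # x) \<in> link (Suc (Suc k)) F"
proof -
  have d4: "d \<in> {0, 1, 2, 3}" using d mod4_in by auto
  have "\<exists>x\<in>BH_verts k. \<exists>a\<in>parity_class True. \<exists>b\<in>parity_class False. a # c # x \<notin> \<Union>F \<and> b # d # x \<notin> \<Union>F"
  proof (rule ccontr)
    assume no: "\<not> ?thesis"
    define Q where "Q x f \<longleftrightarrow> (\<exists>a\<in>parity_class True. a # c # x \<in> f) \<or>
        (\<exists>b\<in>parity_class False. b # d # x \<in> f)" for x f
    show False
    proof (cases "k = 0")
      case True
      \<comment> \<open>For \<open>k = 0\<close> the count yields only two cliques out of at most
        three. Instead, at most one clique meets each copy, so every pair of twins keeps a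
        survivor.\<close>
      have ex: "\<exists>b\<in>parity_class p. [b, e] \<notin> \<Union>F" if e: "e \<in> {0, 1, 2, 3}" for p e
      proof (rule live_in_class[of F "\<lambda>f. slice e f \<noteq> {}" p "[e]" "Suc 0"])
        show "[e] \<in> BH_verts (Suc 0)" using e by simp
        show "card {f \<in> F. slice e f \<noteq> {}} \<le> 1" using sp[OF e] True by simp
        show "slice e f \<noteq> {}" if "[b, e] \<in> f" for b f using that by (auto simp: slice_def)
      qed (use fin cl in \<open>auto simp: live_def\<close>)
      have "[] \<in> BH_verts k" using True by simp
      then show False using ex[OF c, of True] ex[OF d4, of False] no by blast
    next
      case False
      have "2 * card (BH_verts k) \<le> card F"
      proof (rule double_count[OF fin finite_BH_verts, of _ Q])
        fix x assume x: "x \<in> BH_verts k"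
        then consider "\<forall>a\<in>parity_class True. a # c # x \<in> \<Union>F"
          | "\<forall>b\<in>parity_class False. b # d # x \<in> \<Union>F"
          using no by blast
        then show "2 \<le> card {f \<in> F. Q x f}"
        proof cases
          case 1 then show ?thesis
            by (intro two_cliques_cover_class[of F True "c # x"] fin cl) (auto simp: Q_def)
        next
          case 2 then show ?thesis
            by (intro two_cliques_cover_class[of F False "d # x"] fin cl) (auto simp: Q_def)
        qed
      next
        fix x y f
        assume *: "f \<in> F" "Q x f" "Q y f"
        note f = cl[OF *(1)]
        have cross: "z = w" if "a \<in> parity_class True" "a # c # z \<in> f"
            "b \<in> parity_class False" "b # d # w \<in> f" for a b z w
        proof -
          have p: "even a" "odd b" using that even_parity_class by auto
          then have "a # c # z \<noteq> b # d # w" by auto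
          then have "adj (a # c # z) (b # d # w)" using that f by (intro cliqueD)
          then show ?thesis using mod4_shift_neq[of 1 c] by (auto simp: d)
        qed
        have same: "z = w" if "a \<in> parity_class p" "a # e # z \<in> f"
            "b \<in> parity_class p" "b # e # w \<in> f" for a b e p z w
          using clique_same_parity[OF f that(2,4)] that even_parity_class by auto
        show "x = y"
          using *(2,3) cross same unfolding Q_def by metis
      qed
      then show False using four_power_gt[of k] False cd by (simp add: card_BH_verts)
    qed
  qed
  then obtain x a b where *: "x \<in> BH_verts k" "a \<in> parity_class True" "b \<in> parity_class False"
      "a # c # x \<notin> \<Union>F" "b # d # x \<notin> \<Union>F"
    by blast
  have "even a" "odd b" using even_parity_class *(2,3) by auto
  moreover have "a # c # x \<in> live (Suc (Suc k)) F" "b # d # x \<in> live (Suc (Suc k)) F"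
    using * c d4 parity_class_verts by (auto simp: live_def)
  ultimately show ?thesis using that[of a x b] by (simp add: link_def sg_def d)
qed

lemma connected_spread:
  assumes IH: "cliques_removable (Suc k) (2 * k + 1)"
    and fin: "finite F" and cl: "\<And>f. f \<in> F \<Longrightarrow> clique f" and cd: "card F \<le> 2 * k + 3"
    and sp: "\<And>c. c \<in> {0, 1, 2, 3} \<Longrightarrow> card {f \<in> F. slice c f \<noteq> {}} \<le> 2 * k + 1"
    and uv: "u \<in> live (Suc (Suc k)) F" "v \<in> live (Suc (Suc k)) F"
  shows "(u, v) \<in> (link (Suc (Suc k)) F)\<^sup>*"
proof -
  let ?L = "link (Suc (Suc k)) F"
  have copy: "(a # c # x, b # c # y) \<in> ?L\<^sup>*"
    if "a # c # x \<in> live (Suc (Suc k)) F" "b # c # y \<in> live (Suc (Suc k)) F" for a b c x y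
  proof -
    have "c \<in> {0, 1, 2, 3}" using that by (simp add: live_def)
    then show ?thesis using copy_connected[OF IH fin cl sp that] by blast
  qed
  have next_copy: "\<exists>b y. b # ((c + 1) mod 4) # y \<in> live (Suc (Suc k)) F \<and>
      (a # c # x, b # ((c + 1) mod 4) # y) \<in> ?L\<^sup>*"
    if l: "a # c # x \<in> live (Suc (Suc k)) F" for a c x
  proof -
    have c: "c \<in> {0, 1, 2, 3}" using l by (simp add: live_def)
    obtain a' b z where "a' # c # z \<in> live (Suc (Suc k)) F" "b # ((c + 1) mod 4) # z \<in> live (Suc (Suc k)) F"
        "(a' # c # z, b # ((c + 1) mod 4) # z) \<in> ?L"
      using joint[OF fin cl cd sp c refl] by blast
    then show ?thesis using copy[OF l, of a' z] by (meson rtrancl_into_rtrancl)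
  qed
  have to_0: "\<exists>b y. b # 0 # y \<in> live (Suc (Suc k)) F \<and> (w, b # 0 # y) \<in> ?L\<^sup>*"
    if w: "w \<in> live (Suc (Suc k)) F" for w
  proof -
    have s: "\<exists>b y. b # 0 # y \<in> live (Suc (Suc k)) F \<and> (a # c # x, b # 0 # y) \<in> ?L\<^sup>*"
      if "a # c # x \<in> live (Suc (Suc k)) F" "(c + int n) mod 4 = 0" for a c x n
      using that
    proof (induction n arbitrary: a c x)
      case 0
      then have "c = 0" by (auto simp: live_def)
      then show ?case using 0 by auto
    next
      case (Suc n)
      obtain b y where b: "b # ((c + 1) mod 4) # y \<in> live (Suc (Suc k)) F"
          "(a # c # x, b # ((c + 1) mod 4) # y) \<in> ?L\<^sup>*"
        using next_copy Suc.prems(1) by blast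
      have "((c + 1) mod 4 + int n) mod 4 = 0"
        using Suc.prems(2) by (simp add: mod_simps ac_simps)
      from Suc.IH[OF b(1) this] b(2) show ?case by (meson rtrancl_trans)
    qed
    obtain a c x where w_eq: "w = a # c # x" "c \<in> {0, 1, 2, 3}"
      using w by (auto simp: live_def elim!: BH_verts_SucE)
    \<comment> \<open>Going up \<open>4 - c\<close> copies ends in copy 0; from \<open>c = 0\<close>
      the walk goes once round the cycle, which avoids a separate case.\<close>
    then have "(c + int (nat (4 - c))) mod 4 = 0" by auto
    then show ?thesis using s[of a c x "nat (4 - c)"] w by (simp add: w_eq(1))
  qed
  obtain b y where u0: "b # 0 # y \<in> live (Suc (Suc k)) F" "(u, b # 0 # y) \<in> ?L\<^sup>*"
    using to_0[OF uv(1)] by blast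
  obtain b' y' where v0: "b' # 0 # y' \<in> live (Suc (Suc k)) F" "(v, b' # 0 # y') \<in> ?L\<^sup>*"
    using to_0[OF uv(2)] by blast
  have "(u, b' # 0 # y') \<in> ?L\<^sup>*"
    using u0(2) copy[OF u0(1) v0(1)] by (rule rtrancl_trans)
  then show ?thesis using link_rtrancl_sym[OF v0(2)] by (rule rtrancl_trans)
qed

section \<open>Induction on the dimension\<close>

lemma cliques_removable: "cliques_removable (Suc k) (2 * k + 1)"
proof (induction k)
  case 0
  then show ?case unfolding cliques_removable_def using connected_base by simp
next
  case (Suc k)
  have "(u, v) \<in> (link (Suc (Suc k)) F)\<^sup>*"
    if F: "finite F" "card F \<le> 2 * k + 3" "\<And>f. f \<in> F \<Longrightarrow> clique f"
      and uv: "u \<in> live (Suc (Suc k)) F" "v \<in> live (Suc (Suc k)) F" for F u v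
  \<comment> \<open>Either the induction hypothesis applies to every copy, or some copy meets all
    cliques but at most one.\<close>
  proof (cases "\<forall>c\<in>{0, 1, 2, 3}. card {f \<in> F. slice c f \<noteq> {}} \<le> 2 * k + 1")
    case True
    then show ?thesis using connected_spread[OF Suc.IH F(1,3,2) _ uv] by blast
  next
    case False
    then obtain c where c: "c \<in> {0, 1, 2, 3}" "2 * k + 2 \<le> card {f \<in> F. slice c f \<noteq> {}}"
      by (auto simp: not_le Suc_le_eq)
    show ?thesis using connected_crowded[OF Suc.IH F(1,3,2) c uv] by blast
  qed
  then show ?case unfolding cliques_removable_def by simp
qed


section \<open>Agreement of \<open>adj\<close> with the balanced hypercube\<close>

text \<open>This links the recursive form, suited to induction on lists, to the list updates in
  \<open>BH_nbrs\<close>.\<close>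

lemma step_iff_update:
  "step s x y \<longleftrightarrow> y = x \<or> (\<exists>i<length x. y = x[i := (x ! i + s) mod 4])"
proof (induction x arbitrary: y)
  case Nil
  show ?case by (cases y) auto
next
  case (Cons c x)
  show ?case
  proof (cases y)
    case Nil
    then show ?thesis by (auto split: nat.splits)
  next
    case y: (Cons d y')
    have "(\<exists>i<length (c # x). y = (c # x)[i := ((c # x) ! i + s) mod 4]) \<longleftrightarrow>
        y = (c + s) mod 4 # x \<or> (\<exists>i<length x. y = c # x[i := (x ! i + s) mod 4])"
      by (simp only: length_Cons Ex_less_Suc2) simp
    then show ?thesis using Cons.IH[of y'] y by auto
  qed
qed

lemma sg_eq_power: "a \<in> {0, 1, 2, 3} \<Longrightarrow> (-1) ^ nat a = sg a"
  by (auto simp: sg_def)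

lemma parity_neighbours:
  fixes a b :: int
  assumes "a \<in> {0, 1, 2, 3}"
  shows "(\<exists>s\<in>{1, -1}. b = (a + s) mod 4) \<longleftrightarrow> b \<in> {0, 1, 2, 3} \<and> even a \<noteq> even b"
  using assms by (elim insertE emptyE) auto

text \<open>The two kinds of neighbours are those with unchanged tail and those with one shifted
  tail entry. Modulo 4, the entries \<open>a + 1\<close> and \<open>a - 1\<close> are exactly those
  of the other parity.\<close>

lemma BH_nbrs_iff:
  assumes "u \<in> BH_verts (Suc k)"
  shows "v \<in> BH_nbrs (Suc k) u \<longleftrightarrow> v \<in> BH_verts (Suc k) \<and> adj u v"
proof -
  obtain a x where u: "u = a # x" "a \<in> {0, 1, 2, 3}" "x \<in> BH_verts k"
    using assms by (rule BH_verts_SucE)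
  have len: "length x = k" using u by (simp add: BH_verts_def)
  have idx: "(\<exists>i. 1 \<le> i \<and> i \<le> k \<and> P i) \<longleftrightarrow> (\<exists>j<k. P (Suc j))" for P
    by (metis Suc_le_D Suc_le_eq Suc_le_mono One_nat_def le_add1 plus_1_eq_Suc)
  have "v \<in> BH_nbrs (Suc k) u \<longleftrightarrow> (\<exists>s\<in>{1, -1}. v = u[0 := (a + s) mod 4] \<or>
      (\<exists>i. 1 \<le> i \<and> i \<le> k \<and> v = u[0 := (a + s) mod 4, i := (u ! i + sg a) mod 4]))"
    unfolding BH_nbrs_def u(1) nth_Cons_0 sg_eq_power[OF u(2)] diff_Suc_1 by blast
  also have "\<dots> \<longleftrightarrow> (\<exists>s\<in>{1, -1}. v = (a + s) mod 4 # x \<or>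
      (\<exists>j<k. v = (a + s) mod 4 # x[j := (x ! j + sg a) mod 4]))"
    unfolding idx by (simp add: u(1))
  also have "\<dots> \<longleftrightarrow> (\<exists>b y. v = b # y \<and> (\<exists>s\<in>{1, -1}. b = (a + s) mod 4) \<and> step (sg a) x y)"
    unfolding step_iff_update len by blast
  also have "\<dots> \<longleftrightarrow> (\<exists>b y. v = b # y \<and> b \<in> {0, 1, 2, 3} \<and> even a \<noteq> even b \<and> step (sg a) x y)"
    unfolding parity_neighbours[OF u(2)] by blast
  also have "\<dots> \<longleftrightarrow> v \<in> BH_verts (Suc k) \<and> adj u v"
    using step_closed[of "sg a" x _ k] u by (cases v) auto
  finally show ?thesis .
qed

lemma pverts_BH: "pverts (BH n) = BH_verts n"
  by (simp add: BH_def)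

lemma parcs_BH:
  "parcs (BH (Suc k)) = {(u, v). u \<in> BH_verts (Suc k) \<and> v \<in> BH_verts (Suc k) \<and> adj u v}"
  using BH_nbrs_iff by (auto simp: BH_def)

lemma adj_irrefl: "\<not> adj u u"
  by (cases u) auto

lemma pair_graph_BH: "pair_graph (BH (Suc k))"
proof
  show "finite (parcs (BH (Suc k)))"
    by (rule finite_subset[of _ "BH_verts (Suc k) \<times> BH_verts (Suc k)"])
      (auto simp: parcs_BH finite_BH_verts)
  show "symmetric (with_proj (BH (Suc k)))"
    by (auto simp: symmetric_def sym_def parcs_BH intro: adj_sym)
qed (auto simp: pverts_BH parcs_BH finite_BH_verts adj_irrefl)

lemma graph_BH: "graph (with_proj (BH (Suc k)))"
proof -
  interpret pair_graph "BH (Suc k)" by (rule pair_graph_BH)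
  show ?thesis by unfold_locales
qed

section \<open>Lower bound: substructures as cliques\<close>

lemma K11_verts:
  assumes "K\<^bsub>1,1\<^esub> H"
  shows "finite (verts H)" "card (verts H) = 2"
proof -
  obtain U V where *: "verts H = U \<union> V" "U \<inter> V = {}" "card U = 1" "card V = 1"
    using assms by (auto simp: complete_bipartite_digraph_def)
  have UV: "finite U" "finite V" using * by (auto intro: card_ge_0_finite)
  show "finite (verts H)" using UV * by simp
  show "card (verts H) = 2" using UV * by (simp add: card_Un_disjoint)
qed

lemma digraph_iso_card_verts:
  assumes "digraph_iso K K'"
  shows "card (verts K) = card (verts K')"
  using assms by (auto simp: digraph_iso_def pre_digraph.digraph_isomorphism_def card_image)

text \<open>A path from \<open>u\<close> to \<open>v\<close> starts with an arc to a vertex other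
  than \<open>u\<close>, and only \<open>v\<close> is available.\<close>

lemma connected_two_verts_adj:
  assumes "connected_subgraph K G" "card (verts K) \<le> 2" "u \<in> verts K" "v \<in> verts K" "u \<noteq> v"
  shows "(u, v) \<in> arcs_ends G"
proof -
  interpret K: graph K using assms(1) by (simp add: connected_subgraph_def)
  have "strongly_connected K"
    using assms(1) K.symmetric_connected_imp_strongly_connected[OF K.sym_arcs]
    by (simp add: connected_subgraph_def)
  then have "u \<rightarrow>\<^sup>*\<^bsub>K\<^esub> v" using assms by auto
  then obtain w where w: "u \<rightarrow>\<^bsub>K\<^esub> w"
    using assms(5) by (cases rule: K.converse_reachable_cases) auto
  then have "w \<in> verts K" "w \<noteq> u"
    using K.adj_in_verts K.adj_not_same by auto
  have "w = v"
  proof (rule ccontr)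
    assume "w \<noteq> v"
    then have "card {u, v, w} = 3" using \<open>w \<noteq> u\<close> assms(5) by simp
    moreover have "card {u, v, w} \<le> card (verts K)"
      using assms \<open>w \<in> verts K\<close> by (intro card_mono) auto
    ultimately show False using assms(2) by simp
  qed
  moreover have "arcs_ends K \<subseteq> arcs_ends G"
    using assms(1)
    by (auto simp: connected_subgraph_def subgraph_def compatible_def arcs_ends_conv)
  ultimately show ?thesis using w by auto
qed

lemma substructure_clique:
  assumes "K\<^bsub>1,1\<^esub> H" "connected_subgraph K' H" "digraph_iso K K'"
    and K: "connected_subgraph K (with_proj (BH (Suc k)))"
  shows "clique (verts K)"
proof -
  have "card (verts K) \<le> 2"
    using digraph_iso_card_verts[OF assms(3)] K11_verts[OF assms(1)] assms(2)
      card_mono[of "verts H" "verts K'"]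
    by (simp add: connected_subgraph_def subgraph_def)
  then show ?thesis
    using connected_two_verts_adj[OF K] by (auto simp: clique_def parcs_BH)
qed

text \<open>This excludes a trivial remainder. A clique has at most one vertex with a given first
  entry, so removing all of them takes \<open>4 ^ k\<close> cliques; survivors exist with first
  entries 0 and 1.\<close>

lemma live_two:
  assumes "finite F" "\<And>f. f \<in> F \<Longrightarrow> clique f" "card F \<le> 2 * k + 1" "1 \<le> k"
  obtains u v where "u \<in> live (Suc k) F" "v \<in> live (Suc k) F" "u \<noteq> v"
proof -
  have ex: "\<exists>x. a # x \<in> live (Suc k) F" if a: "a \<in> {0, 1, 2, 3}" for a
  proof (rule ccontr)
    assume "\<not> ?thesis"
    then have "\<forall>x\<in>BH_verts k. \<exists>f\<in>F. a # x \<in> f" using a by (auto simp: live_def)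
    then obtain g where g: "\<And>x. x \<in> BH_verts k \<Longrightarrow> g x \<in> F \<and> a # x \<in> g x" by metis
    have "inj_on g (BH_verts k)"
    proof (rule inj_onI)
      fix x y assume "x \<in> BH_verts k" "y \<in> BH_verts k" "g x = g y"
      then show "x = y" using g clique_same_parity[of "g x" a x a y] assms(2) by metis
    qed
    then have "4 ^ k \<le> card F"
      using card_inj_on_le[of g "BH_verts k" F] g assms(1) by (auto simp: card_BH_verts)
    moreover have "2 * k + 1 < 4 ^ k"
      using assms(4) by (induction k rule: nat_induct_at_least) auto
    ultimately show False using assms(3) by simp
  qed
  obtain x y where "0 # x \<in> live (Suc k) F" "1 # y \<in> live (Suc k) F"
    using ex[of 0] ex[of 1] by auto
  then show ?thesis using that[of "0 # x" "1 # y"] by simp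
qed

lemma rtrancl_link_induced:
  assumes "(u, v) \<in> (link (Suc k) F)\<^sup>*" "u \<in> live (Suc k) F"
  shows "(u, v) \<in> rtrancl_on (live (Suc k) F)
           ((arcs_ends (with_proj (BH (Suc k)) \<restriction> live (Suc k) F))\<^sup>s)"
  using assms
proof (induction rule: rtrancl_induct)
  case base
  then show ?case by simp
next
  case (step v w)
  have "(v, w) \<in> arcs_ends (with_proj (BH (Suc k)) \<restriction> live (Suc k) F)"
    using step(2) by (force simp: arcs_ends_conv induce_subgraph_def parcs_BH link_def live_def)
  then show ?case
    using step by (auto simp: link_def symcl_def intro: rtrancl_on_into_rtrancl_on)
qed

lemma substructure_cut_card_ge:
  assumes "1 \<le> k" "K\<^bsub>1,1\<^esub> H" "finite F" "substructure_cut (with_proj (BH (Suc k))) H F"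
  shows "2 * Suc k \<le> card F"
proof (rule ccontr)
  assume "\<not> ?thesis"
  \<comment> \<open>Different subgraphs may share a vertex set; passing to vertex sets can only
    lower the number.\<close>
  define F' where "F' = verts ` F"
  have F': "finite F'" "card F' \<le> 2 * k + 1" "\<And>f. f \<in> F' \<Longrightarrow> clique f"
  proof -
    show "finite F'" using assms by (simp add: F'_def)
    show "card F' \<le> 2 * k + 1"
      using \<open>\<not> 2 * Suc k \<le> card F\<close> card_image_le[OF assms(3), of verts] by (simp add: F'_def)
    show "clique f" if "f \<in> F'" for f
    proof -
      obtain K where K: "K \<in> F" "f = verts K" using \<open>f \<in> F'\<close> by (auto simp: F'_def)
      then obtain K' where "connected_subgraph K' H" "digraph_iso K K'"
        using assms(4) by (auto simp: substructure_cut_def)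
      moreover have "connected_subgraph K (with_proj (BH (Suc k)))"
        using assms(4) K by (auto simp: substructure_cut_def subgraph_cut_def)
      ultimately show ?thesis using substructure_clique[OF assms(2)] K by blast
    qed
  qed
  let ?R = "with_proj (BH (Suc k)) \<restriction> live (Suc k) F'"
  have cut: "\<not> connected ?R \<or> (\<exists>v. verts ?R = {v})"
    using assms(4) by (simp add: substructure_cut_def subgraph_cut_def Let_def live_def F'_def pverts_BH)
  obtain u v where uv: "u \<in> live (Suc k) F'" "v \<in> live (Suc k) F'" "u \<noteq> v"
    using live_two[OF F'(1,3,2) assms(1)] .
  have "connected ?R"
    unfolding connected_conv induce_subgraph_verts
  proof (intro conjI ballI)
    show "live (Suc k) F' \<noteq> {}" using uv by blast
    fix u v assume "u \<in> live (Suc k) F'" "v \<in> live (Suc k) F'"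
    then show "(u, v) \<in> rtrancl_on (live (Suc k) F') ((arcs_ends ?R)\<^sup>s)"
      using cliques_removable[of k] F'
      by (intro rtrancl_link_induced) (simp_all add: cliques_removable_def)
  qed
  with cut obtain w where "live (Suc k) F' = {w}"
    unfolding induce_subgraph_verts by blast
  then show False using uv by (metis singletonD)
qed

section \<open>Upper bound: removing a neighbourhood\<close>

text \<open>The projections \<open>fst\<close> and \<open>snd\<close> make the graph compatible with
  \<open>with_proj (BH n)\<close>, as \<open>subgraph\<close> demands.\<close>

definition single_vertex :: "int list \<Rightarrow> (int list, int list \<times> int list) pre_digraph" where
  "single_vertex v = \<lparr> verts = {v}, arcs = {}, tail = fst, head = snd \<rparr>"

lemma graph_no_arcs:
  assumes "finite (verts G)" "arcs G = {}"
  shows "graph G"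
  using assms by unfold_locales (auto simp: symmetric_conv)

lemma connected_subgraph_single_vertex:
  assumes "graph G" "verts K = {v}" "arcs K = {}" "tail K = tail G" "head K = head G" "v \<in> verts G"
  shows "connected_subgraph K G"
proof -
  interpret G: graph G by fact
  interpret K: graph K using assms by (intro graph_no_arcs) auto
  show ?thesis
    using assms G.wf_digraph K.wf_digraph K.graph_axioms
    by (auto simp: connected_subgraph_def subgraph_def compatible_def connected_conv)
qed

lemma single_vertex_substructure:
  fixes H :: "('a, 'b) pre_digraph"
  assumes "graph H" "verts H \<noteq> {}"
  shows "\<exists>K'. connected_subgraph K' H \<and> digraph_iso (single_vertex v) K'"
proof -
  obtain h where h: "h \<in> verts H" using assms(2) by auto
  \<comment> \<open>There are no arcs to map, so \<open>iso_arcs\<close> is arbitrary; head and tail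
    are those of \<open>H\<close> to make the image compatible with \<open>H\<close>.\<close>
  define i :: "(int list, int list \<times> int list, 'a, 'b) digraph_isomorphism" where
    "i = \<lparr> iso_verts = \<lambda>_. h, iso_arcs = undefined, iso_head = head H, iso_tail = tail H \<rparr>"
  let ?K = "app_iso i (single_vertex v)"
  have "connected_subgraph ?K H"
    using h assms by (intro connected_subgraph_single_vertex[of H ?K h]) (auto simp: i_def single_vertex_def)
  moreover have "graph (single_vertex v)"
    by (rule graph_no_arcs) (simp_all add: single_vertex_def)
  then have "wf_digraph (single_vertex v)"
    by (simp add: graph_def digraph_def fin_digraph_def)
  then have "digraph_iso (single_vertex v) ?K"
    unfolding digraph_iso_def pre_digraph.digraph_isomorphism_def
    by (intro exI[of _ i]) (auto simp: single_vertex_def)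
  ultimately show ?thesis by blast
qed

text \<open>The vertex \<open>z\<close> loses all its neighbours, while its twin \<open>w\<close>,
  not adjacent to it, survives as a second component.\<close>

lemma neighbourhood_substructure_cut:
  assumes "graph H" "verts H \<noteq> {}"
    and F: "F = single_vertex ` {v \<in> BH_verts (Suc k). adj (0 # replicate k 0) v}"
  shows "substructure_cut (with_proj (BH (Suc k))) H F"
proof -
  let ?G = "with_proj (BH (Suc k))"
  define z where "z = (0 :: int) # replicate k 0"
  define w where "w = (2 :: int) # replicate k 0"
  define S where "S = verts ?G - (\<Union>K\<in>F. verts K)"
  have sub: "connected_subgraph K ?G" if "K \<in> F" for K
    using that graph_BH[of k]
    by (auto simp: F single_vertex_def pverts_BH intro!: connected_subgraph_single_vertex)
  have rep: "replicate k 0 \<in> BH_verts k" by (auto simp: BH_verts_def)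
  have S_eq: "S = {v \<in> BH_verts (Suc k). \<not> adj z v}"
    by (auto simp: S_def F single_vertex_def pverts_BH z_def)
  have zw: "z \<in> S" "w \<in> S" "z \<noteq> w"
    using rep by (auto simp: S_eq z_def w_def)
  have "\<not> connected (?G \<restriction> S)"
  proof
    assume "connected (?G \<restriction> S)"
    then have "(z, w) \<in> rtrancl_on S ((arcs_ends (?G \<restriction> S))\<^sup>s)"
      using zw by (simp add: connected_conv)
    then obtain v where "(z, v) \<in> (arcs_ends (?G \<restriction> S))\<^sup>s"
      using zw(3) by (cases rule: converse_rtrancl_on_cases) auto
    then have "adj z v \<and> v \<in> S \<or> adj v z \<and> v \<in> S"
      by (auto simp: symcl_def arcs_ends_conv induce_subgraph_def parcs_BH)
    then show False using zw(1) adj_sym[of v z "Suc k"] by (auto simp: S_eq)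
  qed
  then have "subgraph_cut ?G F"
    using sub by (simp add: subgraph_cut_def Let_def S_def)
  then show ?thesis
    using single_vertex_substructure[OF assms(1,2)] by (auto simp: substructure_cut_def F)
qed

text \<open>Two first entries of the other parity combine with the \<open>k + 1\<close> tails
  counted in \<open>card_step\<close>.\<close>

lemma card_neighbours:
  assumes "a # x \<in> BH_verts (Suc k)"
  shows "card {v \<in> BH_verts (Suc k). adj (a # x) v} = 2 * Suc k"
proof -
  have "{v \<in> BH_verts (Suc k). adj (a # x) v} =
      (\<lambda>(b, y). b # y) ` (parity_class (odd a) \<times> {y. step (sg a) x y})" (is "?L = ?R")
  proof (rule set_eqI)
    fix v
    show "v \<in> ?L \<longleftrightarrow> v \<in> ?R"
    proof (cases v)
      case (Cons b y)
      have "b \<in> {0, 1, 2, 3} \<and> even a \<noteq> even b \<longleftrightarrow> b \<in> parity_class (odd a)"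
        by (auto simp: parity_class_def)
      then show ?thesis using Cons assms step_closed[of "sg a" x y k] by auto
    qed auto
  qed
  moreover have "inj_on (\<lambda>(b, y). b # y) (parity_class (odd a) \<times> {y. step (sg a) x y})"
    by (auto simp: inj_on_def)
  moreover have "card (parity_class p) = 2" for p by (simp add: parity_class_def)
  moreover have "length x = k" using assms by (simp add: BH_verts_def)
  ultimately show ?thesis
    using card_step[OF sg_cases, of a x] by (simp add: card_image card_cartesian_product)
qed

theorem theorem2:
  fixes n :: nat and H :: "('a, 'b) pre_digraph"
  assumes "n \<ge> 2" and "K\<^bsub>1,1\<^esub> H"
  shows "\<kappa>\<^sup>s (with_proj (BH n)) H = enat (2 * n)"
proof -
  obtain k where k: "n = Suc k" "1 \<le> k" using assms(1) by (cases n) auto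
  let ?N = "{v \<in> BH_verts (Suc k). adj (0 # replicate k 0) v}"
  have "0 # replicate k 0 \<in> BH_verts (Suc k)" by (auto simp: BH_verts_def)
  then have "card (single_vertex ` ?N) = 2 * n"
    using card_neighbours[of 0 "replicate k 0" k]
    by (subst card_image) (auto simp: inj_on_def single_vertex_def k)
  moreover have "finite (single_vertex ` ?N)" using finite_BH_verts by simp
  moreover have "graph H" "verts H \<noteq> {}"
    using assms(2) K11_verts[OF assms(2)] by (auto simp: complete_bipartite_digraph_def)
  then have "substructure_cut (with_proj (BH n)) H (single_vertex ` ?N)"
    unfolding k by (intro neighbourhood_substructure_cut) auto
  ultimately have "enat (2 * n) \<in> {enat (card F) | F. finite F \<and> substructure_cut (with_proj (BH n)) H F}"
    by force
  then show ?thesis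
    unfolding substructure_connectivity_def
    using substructure_cut_card_ge[OF k(2) assms(2)]
    by (intro cInf_eq_minimum) (auto simp: k)
qed

end
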